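(* Let $L$ be an atomic lattice with set of atoms $E$, let $\mathcal G$ be a building set in $L$, let $N\subseteq\mathcal G$ be a nested set, and let $\mathcal B_N$ be a Boolean building set on $N$. Let $\Gamma$ denote the lightcone subdivision of $\mathbb R_+^{2N}$ associated to $\mathcal B_N$. (i) The subdivision $\Delta_0^{-1}\Gamma$ of $\mathbb R_+^N$ is given by the domains of linearity of the function $$\sum_{t\in\mathcal B_N}\max_{e\in t}(e^* )$$ on $\mathbb R^N_+$, where $e^*$ ($e\in N$) are the coordinate functions on $\mathbb R^N$. (ii) Let $C_N:=p(\mathbb R_+^N)$ and let $s_N:\mathbb R^E\to\mathbb R^N$ be a linear map with $s_N\circ p|_{\mathbb R^N}=\mathrm{id}_{\mathbb R^N}$. The lightcone subdivision $p(\Delta_0^{-1}\Gamma)$ of $C_N$ associated to $\mathcal B_N$ is given by the domains of linearity of $$\sum_{t\in\mathcal B_N}\max_{e\in t}(e^*\circ s_N)$$ on $C_N$.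
   Context: All lattices are finite. Let $L$ be a lattice with minimum $\hat 0$ and maximum $\hat 1$. $L$ is atomic if every element is the join of the atoms below it; $f\in L$ is identified with the set of atoms $e\le f$. A building set is a subset $\mathcal G\subseteq L_{>\hat 0}$ with $\hat 1\in\mathcal G$ such that for every $f\in L_{>\hat 0}\setminus\mathcal G$, the interval $[\hat 0,f]$ is the product lattice $[\hat 0,g_1]\times\dots\times[\hat 0,g_k]$ (via join), $g_1,\dots,g_k$ being the maximal elements of $\mathcal G$ below $f$. A subset $N\subseteq\mathcal G$ is nested if for all $k\ge2$ and pairwise incomparable $f_1,\dots,f_k\in N$, $f_1\vee\dots\vee f_k\notin\mathcal G$. For nested $N$: $\mathbb R^N$ has basis $N$, $\mathbb R^{2N}$ has basis $f^+,f^-$ ($f\in N$), and $\mathbb R_+^N,\mathbb R_+^{2N}$ are the nonnegative orthants. $\Delta_0:\mathbb R^N\to\mathbb R^{2N}$ is linear with $\hat 1\mapsto\hat 1^+$ (if $\hat 1\in N$) and $g\mapsto g^++g^-$ for $g\ne\hat 1$. $p:\mathbb R^N\to\mathbb R^E$ is linear with $f\mapsto\sum_{e\in f}e$ (such a map $s_N$ as in (ii) always exists). A Boolean building set on $N$ is a collection of nonempty subsets of $N$ containing all singletons and closed under unions of intersecting members. Let $u_{\mathrm{tot}}=\sum_{g\in N}g$ and $\phi:\mathbb R^{2N}\to\mathbb R^N/\langle u_{\mathrm{tot}}\rangle$, $\phi(f^+)=\sum_{g\in N,\,g<f}g$, $\phi(f^-)=\sum_{g\in N,\ g>f\text{ or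 }g\wedge f=\hat 0}g$. The domains of linearity of $x\mapsto\sum_{t\in\mathcal B_N}\min_{g\in t}x_g$ define a complete fan in $\mathbb R^N/\langle u_{\mathrm{tot}}\rangle$; the lightcone subdivision of $\mathbb R_+^{2N}$ associated to $\mathcal B_N$ is the intersection with $\mathbb R_+^{2N}$ of its pullback under $\phi$. *)

theory Defs
  imports "HOL-Analysis.Analysis" "HOL-Library.FuncSet"
begin

text \<open>
  A finite lattice is a type of class \<open>{finite, complete_lattice}\<close>: a nonempty finite lattice is
  complete, and the extra operations of the class are determined by the order.
\<close>

section \<open>Building sets and nested sets\<close>

definition atoms :: "'a::{finite, complete_lattice} set" where
  "atoms = {e. bot < e \<and> (\<forall>x. x < e \<longrightarrow> x = bot)}"

definition atoms_below :: "'a::{finite, complete_lattice} \<Rightarrow> 'a set" where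
  "atoms_below f = {e \<in> atoms. e \<le> f}"

definition atomic_lattice :: "'a::{finite, complete_lattice} itself \<Rightarrow> bool" where
  "atomic_lattice _ \<longleftrightarrow> (\<forall>f::'a. f = Sup (atoms_below f))"

definition maximal_below :: "'a::{finite, complete_lattice} set \<Rightarrow> 'a \<Rightarrow> 'a set" where
  "maximal_below G f = {g \<in> G. g \<le> f \<and> (\<forall>h \<in> G. h \<le> f \<longrightarrow> g \<le> h \<longrightarrow> h = g)}"

text \<open>
  \<open>join_product f F\<close>: taking joins is an isomorphism from the product of the intervals
  \<open>[bot, g]\<close>, \<open>g \<in> F\<close>, with the componentwise order, onto \<open>[bot, f]\<close>.
\<close>

definition join_product :: "'a::{finite, complete_lattice} \<Rightarrow> 'a set \<Rightarrow> bool" where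
  "join_product f F \<longleftrightarrow>
     bij_betw (\<lambda>x. SUP g\<in>F. x g) (\<Pi>\<^sub>E g\<in>F. {bot..g}) {bot..f} \<and>
     (\<forall>x \<in> (\<Pi>\<^sub>E g\<in>F. {bot..g}). \<forall>y \<in> (\<Pi>\<^sub>E g\<in>F. {bot..g}).
        (SUP g\<in>F. x g) \<le> (SUP g\<in>F. y g) \<longleftrightarrow> (\<forall>g\<in>F. x g \<le> y g))"

definition building_set :: "'a::{finite, complete_lattice} set \<Rightarrow> bool" where
  "building_set G \<longleftrightarrow>
     G \<subseteq> {f. bot < f} \<and> top \<in> G \<and>
     (\<forall>f. bot < f \<longrightarrow> f \<notin> G \<longrightarrow> join_product f (maximal_below G f))"

definition nested :: "'a::{finite, complete_lattice} set \<Rightarrow> 'a set \<Rightarrow> bool" where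
  "nested G N \<longleftrightarrow>
     N \<subseteq> G \<and>
     (\<forall>F. F \<subseteq> N \<longrightarrow> 2 \<le> card F \<longrightarrow> (\<forall>f\<in>F. \<forall>g\<in>F. f \<le> g \<longrightarrow> f = g) \<longrightarrow> Sup F \<notin> G)"

definition boolean_building_set :: "'a set \<Rightarrow> 'a set set \<Rightarrow> bool" where
  "boolean_building_set N B \<longleftrightarrow>
     (\<forall>t\<in>B. t \<noteq> {} \<and> t \<subseteq> N) \<and>
     (\<forall>g\<in>N. {g} \<in> B) \<and>
     (\<forall>s\<in>B. \<forall>t\<in>B. s \<inter> t \<noteq> {} \<longrightarrow> s \<union> t \<in> B)"

section \<open>Domains of linearity\<close>

definition linear_on_set :: "('v::real_vector \<Rightarrow> real) \<Rightarrow> 'v set \<Rightarrow> bool" where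
  "linear_on_set h D \<longleftrightarrow> (\<exists>l. linear l \<and> (\<forall>x\<in>D. h x = l x))"

definition domain_of_linearity :: "('v::real_vector \<Rightarrow> real) \<Rightarrow> 'v set \<Rightarrow> 'v set \<Rightarrow> bool" where
  "domain_of_linearity h S D \<longleftrightarrow>
     D \<subseteq> S \<and> convex D \<and> linear_on_set h D \<and>
     (\<forall>D'. D \<subseteq> D' \<longrightarrow> D' \<subseteq> S \<longrightarrow> convex D' \<longrightarrow> linear_on_set h D' \<longrightarrow> D' = D)"

text \<open>
  A fan or subdivision is represented by the set of all its cones, not only the maximal ones.
  The library relation \<open>face_of\<close> admits the empty face, which is not a cone.
\<close>

definition cone_faces :: "'v::real_vector set \<Rightarrow> 'v set set" where
  "cone_faces C = {F. F face_of C \<and> F \<noteq> {}}"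

text \<open>The subdivision of \<open>S\<close> given by the domains of linearity of \<open>h\<close>.\<close>

definition linearity_subdivision :: "('v::real_vector \<Rightarrow> real) \<Rightarrow> 'v set \<Rightarrow> 'v set set" where
  "linearity_subdivision h S = (\<Union>D \<in> {D. domain_of_linearity h S D}. cone_faces D)"

section \<open>Coordinate spaces and the maps between them\<close>

text \<open>This is \<open>real ^ 'i\<close>, whose notation would force the sort of \<open>'i\<close> to be exactly \<open>finite\<close>.\<close>

type_synonym 'i rvec = "(real, 'i) vec"

text \<open>
  For a subset \<open>A\<close> of a finite type \<open>'i\<close>, the space with basis \<open>A\<close> is a coordinate subspace of
  \<open>real ^ 'i\<close>. The space with basis \<open>f\<^sup>+\<close>, \<open>f\<^sup>-\<close> (\<open>f \<in> N\<close>) is \<open>coord_space (N <+> N)\<close> inside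
  \<open>('a + 'a) rvec\<close>, where \<open>Inl f\<close> indexes \<open>f\<^sup>+\<close> and \<open>Inr f\<close> indexes \<open>f\<^sup>-\<close>.
\<close>

definition coord_space :: "'i::finite set \<Rightarrow> 'i rvec set" where
  "coord_space A = {x. \<forall>i. i \<notin> A \<longrightarrow> x $ i = 0}"

definition orthant :: "'i::finite set \<Rightarrow> 'i rvec set" where
  "orthant A = {x \<in> coord_space A. \<forall>i\<in>A. 0 \<le> x $ i}"

definition basis_sum :: "'i::finite set \<Rightarrow> 'i rvec" where
  "basis_sum A = (\<Sum>i\<in>A. axis i 1)"

definition Delta0 :: "'a::{finite, complete_lattice} set \<Rightarrow> 'a rvec \<Rightarrow> ('a + 'a) rvec" where
  "Delta0 N x =
     (\<Sum>g\<in>N. x $ g *\<^sub>R (if g = top then axis (Inl g) 1 else axis (Inl g) 1 + axis (Inr g) 1))"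

definition p_map :: "'a::{finite, complete_lattice} set \<Rightarrow> 'a rvec \<Rightarrow> 'a rvec" where
  "p_map N x = (\<Sum>f\<in>N. x $ f *\<^sub>R basis_sum (atoms_below f))"

definition cone_C :: "'a::{finite, complete_lattice} set \<Rightarrow> 'a rvec set" where
  "cone_C N = p_map N ` orthant N"

text \<open>The class of \<open>x\<close> modulo the line spanned by \<open>u_tot = basis_sum N\<close>, as a coset.\<close>

definition quot_class :: "'a::finite set \<Rightarrow> 'a rvec \<Rightarrow> 'a rvec set" where
  "quot_class N x = {x + c *\<^sub>R basis_sum N | c. True}"

definition phi :: "'a::{finite, complete_lattice} set \<Rightarrow> ('a + 'a) rvec \<Rightarrow> 'a rvec set" where
  "phi N z = quot_class N
     (\<Sum>f\<in>N. z $ Inl f *\<^sub>R basis_sum {g \<in> N. g < f} +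
             z $ Inr f *\<^sub>R basis_sum {g \<in> N. f < g \<or> inf g f = bot})"

section \<open>The lightcone subdivision\<close>

text \<open>
  The function below is not invariant under translation by \<open>u_tot\<close>, but it changes only by a linear
  function, so its domains of linearity are invariant and descend to the quotient.
\<close>

definition quotient_fan :: "'a::finite set \<Rightarrow> 'a set set \<Rightarrow> 'a rvec set set set" where
  "quotient_fan N B =
     (\<lambda>\<sigma>. quot_class N ` \<sigma>) `
       linearity_subdivision (\<lambda>x. \<Sum>t\<in>B. MIN g\<in>t. x $ g) (coord_space N)"

text \<open>Intersecting a fan with the orthant means intersecting its cones with the orthant's faces.\<close>

definition lightcone_subdivision ::
    "'a::{finite, complete_lattice} set \<Rightarrow> 'a set set \<Rightarrow> ('a + 'a) rvec set set" where
  "lightcone_subdivision N B =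
     {{z \<in> \<tau>. phi N z \<in> \<sigma>} | \<sigma> \<tau>. \<sigma> \<in> quotient_fan N B \<and> \<tau> \<in> cone_faces (orthant (N <+> N))}"

definition Delta0_pullback ::
    "'a::{finite, complete_lattice} set \<Rightarrow> ('a + 'a) rvec set set \<Rightarrow> 'a rvec set set" where
  "Delta0_pullback N \<Gamma> = (\<lambda>\<gamma>. {x \<in> coord_space N. Delta0 N x \<in> \<gamma>}) ` \<Gamma>"

text \<open>The lightcone subdivision of \<open>cone_C N\<close>.\<close>

definition lightcone_subdivision_C ::
    "'a::{finite, complete_lattice} set \<Rightarrow> 'a set set \<Rightarrow> 'a rvec set set" where
  "lightcone_subdivision_C N B =
     (\<lambda>\<sigma>. p_map N ` \<sigma>) ` Delta0_pullback N (lightcone_subdivision N B)"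

end

theory Submission
  imports Defs
begin

text \<open>
  The heart of the matter is that \<open>phi\<close> after \<open>Delta0\<close> is minus the quotient map. In a nested set two
  incomparable elements have meet \<open>bot\<close> (\<open>nested_comparable_or_disjoint\<close>), so for \<open>g \<noteq> top\<close> the three
  conditions \<open>f < g\<close>, \<open>g < f\<close>, \<open>inf f g = bot\<close> partition \<open>N - {g}\<close>; hence \<open>g\<^sup>+ + g\<^sup>-\<close> is sent to
  \<open>u_tot - g\<close>. For \<open>g = top\<close> the first condition alone gives \<open>N - {g}\<close>, which is why \<open>Delta0\<close> sends
  \<open>top\<close> to \<open>top\<^sup>+\<close> only (\<open>phi_Delta0\<close>). As a minimum of \<open>- x $ g\<close> is minus a maximum of \<open>x $ g\<close>,
  pulling back the fan of the sum of minima yields the fan of the sum \<open>h\<close> of maxima on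
  \<open>coord_space N\<close>.

  It remains to see that intersecting this fan with the faces of the orthant is the same as forming
  the domains of linearity of \<open>h\<close> on the orthant itself. Two facts give this. First, \<open>h\<close> is a
  pointwise maximum of linear functions, so its domains of linearity are the maximal ones among the
  cells on which one of these functions attains the maximum (\<open>domain_of_linearity_iff\<close>); all these
  functions take the same value at \<open>u_tot\<close>, so the cells are invariant under translation by \<open>u_tot\<close>.
  Since any point is moved into the orthant by such a translation, inclusions between cells can be
  tested inside the orthant (\<open>domains_of_linearity_restrict\<close>). Second, the faces of an intersection of
  two convex cones are the intersections of their faces (\<open>cone_faces_Int\<close>).

  The statement about \<open>cone_C N\<close> is then transport of structure along \<open>p_map N\<close>, which has the linear
  left inverse \<open>s\<close> (\<open>linearity_subdivision_linear_image\<close>).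
\<close>

section \<open>Faces of intersections\<close>

lemma cone_faces_subset: "F \<in> cone_faces C \<Longrightarrow> F \<subseteq> C"
  by (simp add: cone_faces_def face_of_imp_subset)

lemma cone_faces_contain_0:
  assumes "conic C" "F \<in> cone_faces C"
  shows "0 \<in> F"
  using assms face_of_conic conic_contains_0 unfolding cone_faces_def by blast

text \<open>
  For convex \<open>P\<close> and \<open>x \<in> P\<close> this is the smallest face of \<open>P\<close> containing \<open>x\<close>: the points \<open>y\<close> for which
  the segment from \<open>y\<close> to \<open>x\<close> can be prolonged beyond \<open>x\<close> inside \<open>P\<close>. This description makes it evident
  that minimal faces commute with intersections.
\<close>

definition minimal_face :: "'v::real_vector set \<Rightarrow> 'v \<Rightarrow> 'v set" where
  "minimal_face P x = {y \<in> P. \<exists>d>0. x + d *\<^sub>R (x - y) \<in> P}"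

lemma shorter_step_in_convex:
  assumes "convex P" "x \<in> P" "x + d *\<^sub>R v \<in> P" "0 < d'" "d' \<le> d"
  shows "x + d' *\<^sub>R v \<in> P"
proof -
  have d: "0 < d" using assms by simp
  have "(1 - d'/d) *\<^sub>R x + (d'/d) *\<^sub>R (x + d *\<^sub>R v) \<in> P"
    using assms d by (intro convexD_alt) (auto simp: divide_simps)
  moreover have "(1 - d'/d) *\<^sub>R x + (d'/d) *\<^sub>R (x + d *\<^sub>R v) = x + d' *\<^sub>R v"
    using d by (simp add: algebra_simps)
  ultimately show ?thesis by simp
qed

text \<open>
  The face property: if the segment from a point of the segment \<open>[a, b]\<close> to \<open>x\<close> prolongs to a point
  \<open>p \<in> P\<close>, then the line from \<open>a\<close> through \<open>x\<close> meets the segment \<open>[p, b]\<close> beyond \<open>x\<close>.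
\<close>

lemma minimal_face_step:
  assumes P: "convex P" and p: "x + d *\<^sub>R (x - ((1 - u) *\<^sub>R a + u *\<^sub>R b)) \<in> P" and b: "b \<in> P"
    and d: "0 < d" and u: "0 < u" "u < 1"
  shows "\<exists>d'>0. x + d' *\<^sub>R (x - a) \<in> P"
proof -
  (* The coefficient of p for which m p + (1 - m) b lies on the line through a and x. *)
  define m where "m = 1 / (1 + d * u)"
  define d' where "d' = m * (d * (1 - u))"
  have du: "0 < 1 + d * u" using d u by (simp add: add_pos_pos)
  have m: "0 < m" "m \<le> 1" using d u du by (auto simp: m_def)
  have e1: "m * (1 + d) = 1 + d'" and e2: "1 - m = m * (d * u)"
    using du by (auto simp: m_def d'_def field_simps)
  have "d' > 0" using m d u by (simp add: d'_def)
  moreover have "m *\<^sub>R (x + d *\<^sub>R (x - ((1 - u) *\<^sub>R a + u *\<^sub>R b))) + (1 - m) *\<^sub>R b \<in> P"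
    using P p b m by (intro convexD) auto
  moreover have "m *\<^sub>R (x + d *\<^sub>R (x - ((1 - u) *\<^sub>R a + u *\<^sub>R b))) + (1 - m) *\<^sub>R b
      = (m * (1 + d)) *\<^sub>R x - d' *\<^sub>R a - (m * (d * u)) *\<^sub>R b + (1 - m) *\<^sub>R b"
    unfolding d'_def by (simp add: algebra_simps)
  moreover have "\<dots> = x + d' *\<^sub>R (x - a)"
    unfolding e1 e2 by (simp add: algebra_simps)
  ultimately show ?thesis by metis
qed

lemma minimal_face_face_of:
  assumes P: "convex P" and x: "x \<in> P"
  shows "minimal_face P x face_of P"
  unfolding face_of_def
proof (intro conjI ballI impI)
  show "minimal_face P x \<subseteq> P" by (auto simp: minimal_face_def)
  show "convex (minimal_face P x)"
    unfolding convex_alt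
  proof (intro ballI allI impI)
    fix y1 y2 and u :: real
    assume y: "y1 \<in> minimal_face P x" "y2 \<in> minimal_face P x" and u: "0 \<le> u \<and> u \<le> 1"
    obtain d1 d2 where d: "d1 > 0" "x + d1 *\<^sub>R (x - y1) \<in> P" "d2 > 0" "x + d2 *\<^sub>R (x - y2) \<in> P"
      using y by (auto simp: minimal_face_def)
    define d where "d = min d1 d2"
    have "x + d *\<^sub>R (x - y1) \<in> P" "x + d *\<^sub>R (x - y2) \<in> P"
      using d by (auto intro!: shorter_step_in_convex[OF P x d(2)] shorter_step_in_convex[OF P x d(4)]
          simp: d_def)
    then have "(1 - u) *\<^sub>R (x + d *\<^sub>R (x - y1)) + u *\<^sub>R (x + d *\<^sub>R (x - y2)) \<in> P"
      using P u by (intro convexD_alt) auto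
    moreover have "(1 - u) *\<^sub>R (x + d *\<^sub>R (x - y1)) + u *\<^sub>R (x + d *\<^sub>R (x - y2))
        = x + d *\<^sub>R (x - ((1 - u) *\<^sub>R y1 + u *\<^sub>R y2))"
      by (simp add: algebra_simps)
    moreover have "(1 - u) *\<^sub>R y1 + u *\<^sub>R y2 \<in> P"
      using P y u by (intro convexD_alt) (auto simp: minimal_face_def)
    moreover have "d > 0" using d by (simp add: d_def)
    ultimately show "(1 - u) *\<^sub>R y1 + u *\<^sub>R y2 \<in> minimal_face P x"
      unfolding minimal_face_def by auto
  qed
next
  fix a b y
  assume a: "a \<in> P" and b: "b \<in> P" and y: "y \<in> minimal_face P x" and seg: "y \<in> open_segment a b"
  obtain d where d: "d > 0" "x + d *\<^sub>R (x - y) \<in> P"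
    using y by (auto simp: minimal_face_def)
  obtain u where u: "0 < u" "u < 1" "y = (1 - u) *\<^sub>R a + u *\<^sub>R b"
    using seg by (auto simp: in_segment)
  show "a \<in> minimal_face P x"
    using minimal_face_step[OF P, of x d u a b] d u a b by (auto simp: minimal_face_def)
  have "x + d *\<^sub>R (x - ((1 - (1 - u)) *\<^sub>R b + (1 - u) *\<^sub>R a)) \<in> P"
    using d(2) u(3) by (simp add: add.commute)
  from minimal_face_step[OF P this a d(1)] show "b \<in> minimal_face P x"
    using u b by (auto simp: minimal_face_def)
qed

text \<open>
  Points of a face prolong through a relative interior point by openness; conversely, a prolongable
  segment has \<open>x\<close> in its interior, so both its ends lie in every face containing \<open>x\<close>.
\<close>

lemma face_eq_minimal_face:
  fixes P :: "'v::euclidean_space set"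
  assumes F: "F face_of P" and x: "x \<in> rel_interior F"
  shows "F = minimal_face P x"
proof
  have xF: "x \<in> F" using x rel_interior_subset by blast
  have FP: "F \<subseteq> P" and cF: "convex F" using F by (auto simp: face_of_def)
  show "F \<subseteq> minimal_face P x"
  proof
    fix y assume y: "y \<in> F"
    obtain e where e: "e > 1" "(1 - e) *\<^sub>R y + e *\<^sub>R x \<in> F"
      using x y cF convex_rel_interior_iff[of F x] by blast
    have "(1 - e) *\<^sub>R y + e *\<^sub>R x = x + (e - 1) *\<^sub>R (x - y)" by (simp add: algebra_simps)
    then show "y \<in> minimal_face P x"
      unfolding minimal_face_def using e y FP by (auto intro!: exI[of _ "e - 1"])
  qed
  show "minimal_face P x \<subseteq> F"
  proof
    fix y assume "y \<in> minimal_face P x"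
    then obtain d where d: "d > 0" "x + d *\<^sub>R (x - y) \<in> P" and y: "y \<in> P"
      by (auto simp: minimal_face_def)
    show "y \<in> F"
    proof (cases "y = x")
      case False
      (* The parameter at which the segment from y to its prolongation passes through x. *)
      define u where "u = 1 / (1 + d)"
      have u: "0 < u" "u < 1" "u * (1 + d) = 1" using d by (auto simp: u_def)
      have "(1 - u) *\<^sub>R y + u *\<^sub>R (x + d *\<^sub>R (x - y)) = (1 - u * (1 + d)) *\<^sub>R y + (u * (1 + d)) *\<^sub>R x"
        by (simp add: algebra_simps)
      then have "x = (1 - u) *\<^sub>R y + u *\<^sub>R (x + d *\<^sub>R (x - y))" using u(3) by simp
      moreover have "y \<noteq> x + d *\<^sub>R (x - y)"
      proof
        assume "y = x + d *\<^sub>R (x - y)"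
        then have "(1 + d) *\<^sub>R (x - y) = 0" by (simp add: algebra_simps)
        then show False using d False by simp
      qed
      ultimately have "x \<in> open_segment y (x + d *\<^sub>R (x - y))"
        unfolding in_segment using u by blast
      then show ?thesis using face_ofD[OF F] y d xF by blast
    qed (use xF in simp)
  qed
qed

text \<open>
  A nonempty face of \<open>P \<inter> Q\<close> is the minimal face of one of its relative interior points \<open>x\<close>, and
  prolonging a segment within \<open>P \<inter> Q\<close> means prolonging it, by the smaller of two steps, within both.
  Conicity enters because all nonempty faces of a cone contain the origin, so that no
  intersection of them is empty.
\<close>

lemma cone_faces_Int:
  fixes P Q :: "'v::euclidean_space set"
  assumes P: "convex P" "conic P" and Q: "convex Q" "conic Q"
  shows "cone_faces (P \<inter> Q) = {F \<inter> G | F G. F \<in> cone_faces P \<and> G \<in> cone_faces Q}"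
proof (intro subset_antisym subsetI)
  fix H assume "H \<in> cone_faces (P \<inter> Q)"
  then have H: "H face_of P \<inter> Q" "H \<noteq> {}" by (auto simp: cone_faces_def)
  then obtain x where x: "x \<in> rel_interior H"
    using rel_interior_eq_empty face_of_imp_convex by blast
  then have xPQ: "x \<in> P" "x \<in> Q" using H rel_interior_subset face_of_imp_subset by blast+
  have "H = minimal_face (P \<inter> Q) x" using face_eq_minimal_face H x by blast
  also have "\<dots> = minimal_face P x \<inter> minimal_face Q x"
  proof (intro subset_antisym subsetI)
    fix y assume "y \<in> minimal_face P x \<inter> minimal_face Q x"
    then obtain d1 d2 where d: "d1 > 0" "x + d1 *\<^sub>R (x - y) \<in> P" "d2 > 0" "x + d2 *\<^sub>R (x - y) \<in> Q"
      and y: "y \<in> P" "y \<in> Q"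
      by (auto simp: minimal_face_def)
    have "x + min d1 d2 *\<^sub>R (x - y) \<in> P" "x + min d1 d2 *\<^sub>R (x - y) \<in> Q"
      using d shorter_step_in_convex[OF P(1) xPQ(1) d(2)] shorter_step_in_convex[OF Q(1) xPQ(2) d(4)]
      by auto
    moreover have "min d1 d2 > 0" using d by simp
    ultimately show "y \<in> minimal_face (P \<inter> Q) x"
      unfolding minimal_face_def using y by blast
  qed (auto simp: minimal_face_def)
  finally have "H = minimal_face P x \<inter> minimal_face Q x" .
  moreover have "minimal_face P x \<in> cone_faces P" "minimal_face Q x \<in> cone_faces Q"
    using minimal_face_face_of P Q xPQ calculation H(2) by (auto simp: cone_faces_def)
  ultimately show "H \<in> {F \<inter> G | F G. F \<in> cone_faces P \<and> G \<in> cone_faces Q}" by blast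
next
  fix H assume "H \<in> {F \<inter> G | F G. F \<in> cone_faces P \<and> G \<in> cone_faces Q}"
  then obtain F G where FG: "H = F \<inter> G" "F \<in> cone_faces P" "G \<in> cone_faces Q" by blast
  then have "0 \<in> H" using cone_faces_contain_0 P Q by blast
  then show "H \<in> cone_faces (P \<inter> Q)"
    using FG face_of_Int_Int by (auto simp: cone_faces_def)
qed

section \<open>Domains of linearity of a maximum of linear functions\<close>

definition pointwise_max :: "('v::real_vector \<Rightarrow> real) set \<Rightarrow> ('v \<Rightarrow> real) \<Rightarrow> bool" where
  "pointwise_max L h \<longleftrightarrow> (\<forall>l\<in>L. linear l \<and> (\<forall>x. l x \<le> h x)) \<and> (\<forall>x. \<exists>l\<in>L. h x = l x)"

definition active_cell :: "('v::real_vector \<Rightarrow> real) \<Rightarrow> 'v set \<Rightarrow> ('v \<Rightarrow> real) \<Rightarrow> 'v set" where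
  "active_cell h S l = {x \<in> S. h x = l x}"

lemma pointwise_max_ge: "pointwise_max L h \<Longrightarrow> l \<in> L \<Longrightarrow> l x \<le> h x"
  by (auto simp: pointwise_max_def)

text \<open>
  On a segment between two points of the cell, \<open>h\<close> is at most its linear interpolation, which is
  \<open>l \<le> h\<close>.
\<close>

lemma convex_active_cell:
  assumes h: "pointwise_max L h" and l: "l \<in> L" and S: "convex S"
  shows "convex (active_cell h S l)"
  unfolding convex_alt
proof (intro ballI allI impI)
  fix x y and u :: real
  assume x: "x \<in> active_cell h S l" and y: "y \<in> active_cell h S l" and u: "0 \<le> u \<and> u \<le> 1"
  let ?z = "(1 - u) *\<^sub>R x + u *\<^sub>R y"
  obtain l' where l': "l' \<in> L" "h ?z = l' ?z" using h unfolding pointwise_max_def by blast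
  have lin: "linear l" "linear l'" using h l l' by (auto simp: pointwise_max_def)
  have le: "l' x \<le> h x" "l' y \<le> h y" "l ?z \<le> h ?z" using pointwise_max_ge[OF h] l l'(1) by blast+
  have "h ?z = (1 - u) * l' x + u * l' y"
    using l' lin by (simp add: linear_add linear_scale)
  also have "\<dots> \<le> (1 - u) * h x + u * h y"
    using le u by (intro add_mono mult_left_mono) auto
  also have "\<dots> = l ?z"
    using x y lin by (simp add: linear_add linear_scale active_cell_def)
  finally have "h ?z = l ?z" using le by simp
  moreover have "?z \<in> S" using S x y u by (intro convexD_alt) (auto simp: active_cell_def)
  ultimately show "?z \<in> active_cell h S l" by (simp add: active_cell_def)
qed

lemma conic_active_cell:
  assumes h: "pointwise_max L h" and l: "l \<in> L" and S: "conic S"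
  shows "conic (active_cell h S l)"
  unfolding conic_def
proof (intro allI impI)
  fix x and c :: real
  assume x: "x \<in> active_cell h S l" and c: "0 \<le> c"
  obtain l' where l': "l' \<in> L" "h (c *\<^sub>R x) = l' (c *\<^sub>R x)" using h unfolding pointwise_max_def by blast
  have lin: "linear l" "linear l'" using h l l' by (auto simp: pointwise_max_def)
  have le: "l' x \<le> h x" "l (c *\<^sub>R x) \<le> h (c *\<^sub>R x)" using pointwise_max_ge[OF h] l l'(1) by blast+
  have "h (c *\<^sub>R x) = c * l' x" using l' lin by (simp add: linear_scale)
  also have "\<dots> \<le> c * h x" using le c by (intro mult_left_mono) auto
  also have "\<dots> = l (c *\<^sub>R x)" using x lin by (simp add: linear_scale active_cell_def)
  finally have "h (c *\<^sub>R x) = l (c *\<^sub>R x)" using le by simp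
  then show "c *\<^sub>R x \<in> active_cell h S l" using x c S by (auto simp: active_cell_def conic_def)
qed

text \<open>
  Choose \<open>l\<close> attaining the maximum at a relative interior point \<open>x\<close> of \<open>D\<close>. On \<open>D\<close> the difference
  \<open>h - l\<close> is nonnegative and agrees with a linear function; as it vanishes at \<open>x\<close>, it vanishes on all
  of \<open>D\<close>.
\<close>

lemma linear_on_set_imp_active:
  fixes D :: "'v::euclidean_space set"
  assumes h: "pointwise_max L h" and D: "convex D" "D \<noteq> {}" and lin: "linear_on_set h D"
  obtains l where "l \<in> L" "\<And>x. x \<in> D \<Longrightarrow> h x = l x"
proof -
  obtain m where m: "linear m" "\<And>x. x \<in> D \<Longrightarrow> h x = m x"
    using lin by (auto simp: linear_on_set_def)
  obtain x where x: "x \<in> rel_interior D" using D rel_interior_eq_empty by blast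
  then have xD: "x \<in> D" using rel_interior_subset by blast
  obtain l where l: "l \<in> L" "h x = l x" using h unfolding pointwise_max_def by blast
  have ll: "linear l" "\<And>y. l y \<le> h y" using h l by (auto simp: pointwise_max_def)
  have "h y = l y" if y: "y \<in> D" for y
  proof -
    obtain e where e: "e > 1" "(1 - e) *\<^sub>R y + e *\<^sub>R x \<in> D"
      using x y D convex_rel_interior_iff[of D x] by blast
    have "l ((1 - e) *\<^sub>R y + e *\<^sub>R x) \<le> m ((1 - e) *\<^sub>R y + e *\<^sub>R x)"
      using ll(2) m(2) e(2) by metis
    then have "(1 - e) * l y + e * l x \<le> (1 - e) * m y + e * m x"
      using m ll by (simp add: linear_add linear_scale)
    then have "(e - 1) * m y \<le> (e - 1) * l y"
      using l m(2)[OF xD] by (simp add: algebra_simps)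
    then have "m y \<le> l y" using e by simp
    then show ?thesis using ll(2)[of y] m(2)[OF y] by simp
  qed
  then show ?thesis using that l by blast
qed

lemma domain_of_linearity_iff:
  fixes S :: "'v::euclidean_space set"
  assumes h: "pointwise_max L h" and S: "convex S" "S \<noteq> {}"
  shows "domain_of_linearity h S D \<longleftrightarrow>
    (\<exists>l\<in>L. D = active_cell h S l \<and>
       (\<forall>l'\<in>L. active_cell h S l \<subseteq> active_cell h S l' \<longrightarrow> active_cell h S l' = active_cell h S l))"
proof
  have cell: "active_cell h S l \<subseteq> S" "convex (active_cell h S l)" "linear_on_set h (active_cell h S l)"
    if "l \<in> L" for l
    using that h convex_active_cell[OF h that S(1)]
    by (auto simp: active_cell_def linear_on_set_def pointwise_max_def)
  {
    assume D: "domain_of_linearity h S D"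
    have maxD: "D' = D" if "D \<subseteq> D'" "D' \<subseteq> S" "convex D'" "linear_on_set h D'" for D'
      using D that by (auto simp: domain_of_linearity_def)
    obtain x where "x \<in> S" using S by blast
    obtain l0 where "l0 \<in> L" "h x = l0 x" using h unfolding pointwise_max_def by blast
    then have "D \<noteq> {}" using maxD[of "active_cell h S l0"] cell[of l0] \<open>x \<in> S\<close>
      by (auto simp: active_cell_def)
    then obtain l where l: "l \<in> L" "\<And>x. x \<in> D \<Longrightarrow> h x = l x"
      using linear_on_set_imp_active[OF h] D unfolding domain_of_linearity_def by metis
    have "D \<subseteq> active_cell h S l" using l D by (auto simp: active_cell_def domain_of_linearity_def)
    then have "D = active_cell h S l" using maxD cell l by blast
    then show "\<exists>l\<in>L. D = active_cell h S l \<and>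
       (\<forall>l'\<in>L. active_cell h S l \<subseteq> active_cell h S l' \<longrightarrow> active_cell h S l' = active_cell h S l)"
      using l maxD cell by blast
  }
  assume "\<exists>l\<in>L. D = active_cell h S l \<and>
       (\<forall>l'\<in>L. active_cell h S l \<subseteq> active_cell h S l' \<longrightarrow> active_cell h S l' = active_cell h S l)"
  then obtain l where l: "l \<in> L" "D = active_cell h S l"
    "\<And>l'. l' \<in> L \<Longrightarrow> D \<subseteq> active_cell h S l' \<Longrightarrow> active_cell h S l' = D" by blast
  show "domain_of_linearity h S D"
    unfolding domain_of_linearity_def
  proof (intro conjI allI impI)
    fix D' assume D': "D \<subseteq> D'" "D' \<subseteq> S" "convex D'" "linear_on_set h D'"
    show "D' = D"
    proof (cases "D' = {}")
      case False
      then obtain l' where l': "l' \<in> L" "\<And>x. x \<in> D' \<Longrightarrow> h x = l' x"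
        using linear_on_set_imp_active[OF h D'(3) _ D'(4)] by metis
      then have "D' \<subseteq> active_cell h S l'" using D' by (auto simp: active_cell_def)
      then show ?thesis using l(3)[OF l'(1)] D' by blast
    qed (use D' in blast)
  qed (use cell l in auto)
qed

lemma linearity_domain_convex_conic:
  fixes S :: "'v::euclidean_space set"
  assumes h: "pointwise_max L h" and S: "convex S" "conic S" "S \<noteq> {}"
    and D: "domain_of_linearity h S D"
  shows "convex D" "conic D"
proof -
  obtain l where l: "l \<in> L" "D = active_cell h S l"
    using D domain_of_linearity_iff[OF h S(1,3)] by blast
  then show "convex D" "conic D"
    using convex_active_cell[OF h l(1) S(1)] conic_active_cell[OF h l(1) S(2)]
    by auto
qed

text \<open>
  Where all members of \<open>L\<close> agree at \<open>u\<close>, translation by \<open>c *\<^sub>R u\<close> adds the same constant to each of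
  them, so it does not change which of them are maximal.
\<close>

lemma active_cell_translate:
  assumes h: "pointwise_max L h" and k: "\<forall>l\<in>L. l u = k" and l: "l \<in> L"
    and V: "subspace V" "u \<in> V" and x: "x \<in> active_cell h V l"
  shows "x + c *\<^sub>R u \<in> active_cell h V l"
proof -
  obtain l' where l': "l' \<in> L" "h (x + c *\<^sub>R u) = l' (x + c *\<^sub>R u)"
    using h unfolding pointwise_max_def by blast
  have lin: "linear l" "linear l'" using h l l' by (auto simp: pointwise_max_def)
  have le: "l' x \<le> h x" "l (x + c *\<^sub>R u) \<le> h (x + c *\<^sub>R u)"
    using pointwise_max_ge[OF h] l l'(1) by blast+
  have "h (x + c *\<^sub>R u) = l' x + c * k" using l' lin k by (simp add: linear_add linear_scale)
  also have "\<dots> \<le> h x + c * k" using le by simp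
  also have "\<dots> = l (x + c *\<^sub>R u)"
    using x lin k l by (simp add: linear_add linear_scale active_cell_def)
  finally have "h (x + c *\<^sub>R u) = l (x + c *\<^sub>R u)" using le by simp
  then show ?thesis using x V by (simp add: active_cell_def subspace_add subspace_scale)
qed

text \<open>
  A cell of \<open>V\<close> is recovered from its part in \<open>S\<close> by translating along \<open>u\<close>, so an inclusion between
  two cells holds in \<open>V\<close> as soon as it holds in \<open>S\<close>; therefore the same cells are maximal.
\<close>

lemma domains_of_linearity_restrict:
  fixes V :: "'v::euclidean_space set"
  assumes h: "pointwise_max L h" and k: "\<forall>l\<in>L. l u = k"
    and V: "subspace V" "u \<in> V" and S: "convex S" "S \<noteq> {}" "S \<subseteq> V"
    and absorb: "\<forall>x\<in>V. \<exists>c. x + c *\<^sub>R u \<in> S"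
  shows "{D. domain_of_linearity h S D} = (\<lambda>D. D \<inter> S) ` {D. domain_of_linearity h V D}"
proof -
  have cellS: "active_cell h S l = active_cell h V l \<inter> S" for l
    using S by (auto simp: active_cell_def)
  have sub: "active_cell h V l \<subseteq> active_cell h V l'"
    if le: "active_cell h S l \<subseteq> active_cell h S l'" and l: "l \<in> L" "l' \<in> L" for l l'
  proof
    fix x assume x: "x \<in> active_cell h V l"
    then obtain c where "x + c *\<^sub>R u \<in> S" using absorb by (auto simp: active_cell_def)
    then have "x + c *\<^sub>R u \<in> active_cell h V l'"
      using active_cell_translate[OF h k l(1) V x, of c] le cellS by blast
    then have "(x + c *\<^sub>R u) + (- c) *\<^sub>R u \<in> active_cell h V l'"
      by (rule active_cell_translate[OF h k l(2) V])
    then show "x \<in> active_cell h V l'" by simp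
  qed
  have sub_iff: "active_cell h S l \<subseteq> active_cell h S l' \<longleftrightarrow> active_cell h V l \<subseteq> active_cell h V l'"
    if "l \<in> L" "l' \<in> L" for l l'
    using sub[OF _ that] cellS by blast
  have eq_iff: "active_cell h S l = active_cell h S l' \<longleftrightarrow> active_cell h V l = active_cell h V l'"
    if "l \<in> L" "l' \<in> L" for l l'
    using sub_iff that by (simp add: set_eq_subset)
  have VV: "convex V" "V \<noteq> {}" using V subspace_imp_convex by auto
  show ?thesis
  proof (intro subset_antisym subsetI)
    fix D assume "D \<in> {D. domain_of_linearity h S D}"
    then obtain l where l: "l \<in> L" "D = active_cell h S l"
      "\<And>l'. l' \<in> L \<Longrightarrow> active_cell h S l \<subseteq> active_cell h S l' \<Longrightarrow> active_cell h S l' = active_cell h S l"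
      using domain_of_linearity_iff[OF h S(1,2)] by auto
    have "domain_of_linearity h V (active_cell h V l)"
      unfolding domain_of_linearity_iff[OF h VV] using l sub_iff eq_iff by metis
    then show "D \<in> (\<lambda>D. D \<inter> S) ` {D. domain_of_linearity h V D}"
      using l cellS by blast
  next
    fix D assume "D \<in> (\<lambda>D. D \<inter> S) ` {D. domain_of_linearity h V D}"
    then obtain l where l: "l \<in> L" "D = active_cell h V l \<inter> S"
      "\<And>l'. l' \<in> L \<Longrightarrow> active_cell h V l \<subseteq> active_cell h V l' \<Longrightarrow> active_cell h V l' = active_cell h V l"
      using domain_of_linearity_iff[OF h VV] by auto
    have "domain_of_linearity h S (active_cell h S l)"
      unfolding domain_of_linearity_iff[OF h S(1,2)] using l sub_iff eq_iff by metis
    then show "D \<in> {D. domain_of_linearity h S D}"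
      using l cellS by simp
  qed
qed

lemma linearity_subdivision_restrict:
  fixes V :: "'v::euclidean_space set"
  assumes h: "pointwise_max L h" and k: "\<forall>l\<in>L. l u = k"
    and V: "subspace V" "u \<in> V" and S: "convex S" "conic S" "S \<noteq> {}" "S \<subseteq> V"
    and absorb: "\<forall>x\<in>V. \<exists>c. x + c *\<^sub>R u \<in> S"
  shows "linearity_subdivision h S =
    {H \<inter> F | H F. H \<in> linearity_subdivision h V \<and> F \<in> cone_faces S}"
proof -
  have VV: "convex V" "conic V" "V \<noteq> {}" using V subspace_imp_convex subspace_imp_conic by auto
  have "linearity_subdivision h S =
      (\<Union>D \<in> {D. domain_of_linearity h V D}. cone_faces (D \<inter> S))"
    unfolding linearity_subdivision_def
      domains_of_linearity_restrict[OF h k V S(1,3,4) absorb] by simp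
  also have "\<dots> = (\<Union>D \<in> {D. domain_of_linearity h V D}.
      {H \<inter> F | H F. H \<in> cone_faces D \<and> F \<in> cone_faces S})"
    using cone_faces_Int[OF linearity_domain_convex_conic[OF h VV] S(1,2)]
    by (intro SUP_cong) simp_all
  also have "\<dots> = {H \<inter> F | H F. H \<in> linearity_subdivision h V \<and> F \<in> cone_faces S}"
    unfolding linearity_subdivision_def by blast
  finally show ?thesis .
qed

text \<open>
  Faces inherit the invariance of their cell, because \<open>x\<close> is the midpoint of \<open>x + c *\<^sub>R u\<close> and
  \<open>x - c *\<^sub>R u\<close>.
\<close>

lemma linearity_subdivision_translate:
  fixes V :: "'v::euclidean_space set"
  assumes h: "pointwise_max L h" and k: "\<forall>l\<in>L. l u = k"
    and V: "subspace V" "u \<in> V"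
    and F: "F \<in> linearity_subdivision h V" and x: "x \<in> F"
  shows "x + c *\<^sub>R u \<in> F"
proof (cases "c *\<^sub>R u = 0")
  case False
  have VV: "convex V" "V \<noteq> {}" using V subspace_imp_convex by auto
  obtain D where D: "domain_of_linearity h V D" "F face_of D"
    using F by (auto simp: linearity_subdivision_def cone_faces_def)
  obtain l where l: "l \<in> L" "D = active_cell h V l"
    using D domain_of_linearity_iff[OF h VV] by blast
  have "x \<in> D" using D x face_of_imp_subset by blast
  then have D2: "x + c *\<^sub>R u \<in> D" "x + (- c) *\<^sub>R u \<in> D"
    using active_cell_translate[OF h k l(1) V] l by blast+
  have "x = (1 - 1/2) *\<^sub>R (x + c *\<^sub>R u) + (1/2) *\<^sub>R (x + (- c) *\<^sub>R u)"
    by (simp add: algebra_simps flip: scaleR_add_left)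
  moreover have "x + c *\<^sub>R u \<noteq> x + (- c) *\<^sub>R u"
  proof
    assume "x + c *\<^sub>R u = x + (- c) *\<^sub>R u"
    moreover have "(c + c) *\<^sub>R u = (x + c *\<^sub>R u) - (x + (- c) *\<^sub>R u)"
      by (simp only: scaleR_add_left scaleR_minus_left) simp
    ultimately have "(c + c) *\<^sub>R u = 0" by simp
    then show False using False by simp
  qed
  ultimately have "x \<in> open_segment (x + c *\<^sub>R u) (x + (- c) *\<^sub>R u)"
    unfolding in_segment by (intro conjI exI[of _ "1/2"]) auto
  then show ?thesis using face_ofD[OF D(2)] D2 x by blast
next
  case True
  then show ?thesis using x by (simp only: add_0_right)
qed

section \<open>Transport along linear maps\<close>

lemma linearity_subdivision_cong:
  assumes "\<And>x. x \<in> S \<Longrightarrow> h x = h' x"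
  shows "linearity_subdivision h S = linearity_subdivision h' S"
proof -
  have "linear_on_set h D \<longleftrightarrow> linear_on_set h' D" if "D \<subseteq> S" for D
    using that assms by (auto simp: linear_on_set_def subset_iff)
  then have "domain_of_linearity h S D \<longleftrightarrow> domain_of_linearity h' S D" for D
    unfolding domain_of_linearity_def by blast
  then show ?thesis by (simp add: linearity_subdivision_def)
qed

lemma linearity_subdivision_uminus:
  "linearity_subdivision (\<lambda>x. - h x) S = linearity_subdivision h S"
proof -
  have *: "linear_on_set (\<lambda>x. - h x) D" if "linear_on_set h D" for h :: "'a \<Rightarrow> real" and D
    using that linear_compose_neg unfolding linear_on_set_def by fastforce
  have "linear_on_set (\<lambda>x. - h x) D \<longleftrightarrow> linear_on_set h D" for D
    using *[of h D] *[of "\<lambda>x. - h x" D] by auto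
  then show ?thesis by (simp add: linearity_subdivision_def domain_of_linearity_def)
qed

text \<open>
  Injectivity of \<open>f\<close> is required on \<open>D\<close> only, in the form of a linear left inverse: \<open>p_map N\<close> is not
  injective on the whole of the type that contains its domain \<open>coord_space N\<close>.
\<close>

lemma cone_faces_linear_image:
  assumes f: "linear f" and g: "linear g" and gf: "\<forall>x\<in>D. g (f x) = x"
    and F: "F \<in> cone_faces D"
  shows "f ` F \<in> cone_faces (f ` D)"
proof -
  have F': "F face_of D" "F \<noteq> {}" "F \<subseteq> D" using F by (auto simp: cone_faces_def face_of_def)
  have "f ` F face_of f ` D"
    unfolding face_of_def
  proof (intro conjI ballI impI)
    fix a b y assume "a \<in> f ` D" "b \<in> f ` D" "y \<in> f ` F" and seg: "y \<in> open_segment a b"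
    then obtain a' b' y' where ab: "a = f a'" "b = f b'" "y = f y'" "a' \<in> D" "b' \<in> D" "y' \<in> F" by auto
    obtain u where u: "a \<noteq> b" "0 < u" "u < 1" "y = (1 - u) *\<^sub>R a + u *\<^sub>R b"
      using seg by (auto simp: in_segment)
    have "g y = (1 - u) *\<^sub>R g a + u *\<^sub>R g b" using u(4) g by (simp add: linear_add linear_scale)
    then have "y' = (1 - u) *\<^sub>R a' + u *\<^sub>R b'" using ab gf F' by auto
    then have "y' \<in> open_segment a' b'" using u ab unfolding in_segment by blast
    then show "a \<in> f ` F" "b \<in> f ` F" using face_ofD[OF F'(1)] ab by blast+
  qed (use F' f in \<open>auto intro: convex_linear_image face_of_imp_convex\<close>)
  then show ?thesis using F' by (simp add: cone_faces_def)
qed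

lemma cone_faces_linear_vimage:
  assumes f: "linear f" and F: "F \<in> cone_faces D" and S: "convex S" "f ` S \<subseteq> D"
    and ne: "\<exists>x\<in>S. f x \<in> F"
  shows "{x \<in> S. f x \<in> F} \<in> cone_faces S"
proof -
  have F': "F face_of D" using F by (auto simp: cone_faces_def)
  have "{x \<in> S. f x \<in> F} face_of S"
    unfolding face_of_def
  proof (intro conjI ballI impI)
    have "{x \<in> S. f x \<in> F} = S \<inter> f -` F" by auto
    then show "convex {x \<in> S. f x \<in> F}"
      using S f F' by (simp add: convex_Int convex_linear_vimage face_of_imp_convex)
  next
    fix a b y assume a: "a \<in> S" and b: "b \<in> S" and y: "y \<in> {x \<in> S. f x \<in> F}"
      and seg: "y \<in> open_segment a b"
    obtain u where u: "a \<noteq> b" "0 < u" "u < 1" "y = (1 - u) *\<^sub>R a + u *\<^sub>R b"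
      using seg by (auto simp: in_segment)
    have fy: "f y = (1 - u) *\<^sub>R f a + u *\<^sub>R f b" using u(4) f by (simp add: linear_add linear_scale)
    have "f a \<in> F \<and> f b \<in> F"
    proof (cases "f a = f b")
      case True
      then have "f y = f a" using fy by (simp flip: scaleR_add_left)
      then show ?thesis using y True by simp
    next
      case False
      then have "f y \<in> open_segment (f a) (f b)" using u fy unfolding in_segment by blast
      then show ?thesis using face_ofD[OF F'] a b y S by blast
    qed
    then show "a \<in> {x \<in> S. f x \<in> F}" "b \<in> {x \<in> S. f x \<in> F}" using a b by auto
  qed auto
  then show ?thesis using ne by (auto simp: cone_faces_def)
qed

lemma domain_of_linearity_linear_image:
  assumes f: "linear f" and g: "linear g" and gf: "\<forall>x\<in>S. g (f x) = x"
    and D: "domain_of_linearity h S D"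
  shows "domain_of_linearity (\<lambda>y. h (g y)) (f ` S) (f ` D)"
proof -
  have DS: "D \<subseteq> S" "convex D" "linear_on_set h D"
    and maxD: "\<And>D'. D \<subseteq> D' \<Longrightarrow> D' \<subseteq> S \<Longrightarrow> convex D' \<Longrightarrow> linear_on_set h D' \<Longrightarrow> D' = D"
    using D by (auto simp: domain_of_linearity_def)
  obtain m where m: "linear m" "\<And>x. x \<in> D \<Longrightarrow> h x = m x"
    using DS by (auto simp: linear_on_set_def)
  show ?thesis
    unfolding domain_of_linearity_def
  proof (intro conjI allI impI)
    have "\<forall>y\<in>f ` D. h (g y) = (m \<circ> g) y" using m DS gf by auto
    moreover have "linear (m \<circ> g)" using m g by (intro linear_compose)
    ultimately show "linear_on_set (\<lambda>y. h (g y)) (f ` D)"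
      unfolding linear_on_set_def by blast
  next
    fix D' assume D': "f ` D \<subseteq> D'" "D' \<subseteq> f ` S" "convex D'" "linear_on_set (\<lambda>y. h (g y)) D'"
    have fg: "f (g y) = y" if "y \<in> D'" for y using that D'(2) gf by auto
    have "g ` D' = D"
    proof (rule maxD)
      show "D \<subseteq> g ` D'" using D'(1) gf DS by force
      show "g ` D' \<subseteq> S" using D'(2) gf by auto
      show "convex (g ` D')" using D' g by (simp add: convex_linear_image)
      obtain n where n: "linear n" "\<And>y. y \<in> D' \<Longrightarrow> h (g y) = n y"
        using D'(4) by (auto simp: linear_on_set_def)
      have "\<forall>x\<in>g ` D'. h x = (n \<circ> f) x" using n fg by auto
      moreover have "linear (n \<circ> f)" using n f by (intro linear_compose)
      ultimately show "linear_on_set h (g ` D')" unfolding linear_on_set_def by blast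
    qed
    then have "f ` D = f ` g ` D'" by simp
    also have "\<dots> = D'" using fg by force
    finally show "D' = f ` D" ..
  qed (use DS f in \<open>auto intro: convex_linear_image\<close>)
qed

lemma linearity_subdivision_linear_image_subset:
  assumes f: "linear f" and g: "linear g" and gf: "\<forall>x\<in>S. g (f x) = x"
  shows "(`) f ` linearity_subdivision h S \<subseteq> linearity_subdivision (\<lambda>y. h (g y)) (f ` S)"
proof
  fix K assume "K \<in> (`) f ` linearity_subdivision h S"
  then obtain D F where D: "domain_of_linearity h S D" "F \<in> cone_faces D" "K = f ` F"
    by (auto simp: linearity_subdivision_def)
  then have "D \<subseteq> S" by (auto simp: domain_of_linearity_def)
  then have "K \<in> cone_faces (f ` D)" using cone_faces_linear_image[OF f g] gf D by blast
  then show "K \<in> linearity_subdivision (\<lambda>y. h (g y)) (f ` S)"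
    using domain_of_linearity_linear_image[OF f g gf D(1)] by (auto simp: linearity_subdivision_def)
qed

text \<open>
  The inclusion from left to right is the other one applied to \<open>g\<close>, whose left inverse on \<open>f ` S\<close> is
  \<open>f\<close>.
\<close>

lemma linearity_subdivision_linear_image:
  assumes f: "linear f" and g: "linear g" and gf: "\<forall>x\<in>S. g (f x) = x"
  shows "linearity_subdivision (\<lambda>y. h (g y)) (f ` S) = (`) f ` linearity_subdivision h S"
proof (rule subset_antisym[OF subsetI linearity_subdivision_linear_image_subset[OF f g gf]])
  fix K assume K: "K \<in> linearity_subdivision (\<lambda>y. h (g y)) (f ` S)"
  have fg: "\<forall>y\<in>f ` S. f (g y) = y" using gf by auto
  have KS: "K \<subseteq> f ` S"
    using K face_of_imp_subset
    by (fastforce simp: linearity_subdivision_def cone_faces_def domain_of_linearity_def)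
  have gfS: "g ` f ` S = S" using gf by force
  have "(`) g ` linearity_subdivision (\<lambda>y. h (g y)) (f ` S)
      \<subseteq> linearity_subdivision (\<lambda>x. h (g (f x))) (g ` f ` S)"
    by (rule linearity_subdivision_linear_image_subset[OF g f fg])
  also have "\<dots> = linearity_subdivision h S"
    unfolding gfS using gf by (intro linearity_subdivision_cong) simp
  finally have "g ` K \<in> linearity_subdivision h S" using K by (simp add: image_subset_iff)
  moreover have "f ` g ` K = (\<lambda>y. y) ` K"
    unfolding image_image using fg KS by (intro image_cong refl) blast
  then have "K = f ` g ` K" by simp
  ultimately show "K \<in> (`) f ` linearity_subdivision h S" by blast
qed

section \<open>Sums of coordinate maxima\<close>

text \<open>
  A sum of maxima is the maximum, over all ways \<open>c\<close> of choosing one element of each \<open>t \<in> B\<close>, of the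
  sums of the chosen coordinates.
\<close>

lemma pointwise_max_sum_Max:
  fixes B :: "'i::finite set set"
  assumes "\<forall>t\<in>B. t \<noteq> {}"
  shows "pointwise_max {\<lambda>x :: 'i rvec. \<Sum>t\<in>B. x $ c t | c. \<forall>t\<in>B. c t \<in> t} (\<lambda>x. \<Sum>t\<in>B. MAX e\<in>t. x $ e)"
  unfolding pointwise_max_def
proof (intro conjI ballI allI)
  fix l assume "l \<in> {\<lambda>x :: 'i rvec. \<Sum>t\<in>B. x $ c t | c. \<forall>t\<in>B. c t \<in> t}"
  then obtain c where c: "l = (\<lambda>x. \<Sum>t\<in>B. x $ c t)" "\<forall>t\<in>B. c t \<in> t" by blast
  show "linear l"
    unfolding c(1) by (intro linear_compose_sum ballI linearI) simp_all
  show "l x \<le> (\<Sum>t\<in>B. MAX e\<in>t. x $ e)" for x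
    unfolding c(1) using c(2) by (intro sum_mono) auto
next
  fix x :: "'i rvec"
  have "\<exists>e\<in>t. x $ e = (MAX e\<in>t. x $ e)" if "t \<in> B" for t
    using Max_in[of "($) x ` t"] assms that by fastforce
  then obtain c where "\<forall>t\<in>B. c t \<in> t \<and> x $ c t = (MAX e\<in>t. x $ e)" by metis
  then show "\<exists>l\<in>{\<lambda>x. \<Sum>t\<in>B. x $ c t | c. \<forall>t\<in>B. c t \<in> t}. (\<Sum>t\<in>B. MAX e\<in>t. x $ e) = l x"
    by (intro bexI[of _ "\<lambda>x. \<Sum>t\<in>B. x $ c t"]) auto
qed

lemma sum_Min_eq_neg_sum_Max:
  fixes x :: "'i::finite rvec"
  assumes "\<forall>t\<in>B. t \<noteq> {}"
  shows "(\<Sum>t\<in>B. MIN g\<in>t. x $ g) = - (\<Sum>t\<in>B. MAX g\<in>t. (- x) $ g)"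
proof -
  have "(MIN g\<in>t. x $ g) = - (MAX g\<in>t. (- x) $ g)" if "t \<in> B" for t
    using assms that minus_Max_eq_Min[of "(\<lambda>g. (- x) $ g) ` t"] by (simp add: image_image)
  then show ?thesis by (simp add: sum_negf)
qed

section \<open>Coordinate subspaces and orthants\<close>

lemma subspace_coord_space: "subspace (coord_space A)"
  by (auto simp: subspace_def coord_space_def)

lemma orthant_subset: "orthant A \<subseteq> coord_space A"
  by (auto simp: orthant_def)

lemma orthant_iff: "x \<in> orthant A \<longleftrightarrow> x \<in> coord_space A \<and> (\<forall>i. 0 \<le> x $ i)"
  by (force simp: orthant_def coord_space_def)

lemma convex_orthant: "convex (orthant A)"
  by (auto simp: convex_alt orthant_iff coord_space_def)

lemma conic_orthant: "conic (orthant A)"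
  by (auto simp: conic_def orthant_iff coord_space_def)

lemma zero_in_orthant: "0 \<in> orthant A"
  by (simp add: orthant_iff coord_space_def)

lemma basis_sum_nth: "basis_sum A $ i = (if i \<in> A then 1 else 0)"
  by (simp add: basis_sum_def axis_def)

lemma basis_sum_in_coord_space: "basis_sum A \<in> coord_space A"
  by (simp add: coord_space_def basis_sum_nth)

lemma coord_space_translate_into_orthant:
  assumes "x \<in> coord_space A"
  shows "\<exists>c. x + c *\<^sub>R basis_sum A \<in> orthant A"
proof -
  (* Every coordinate of x is at least minus the norm of x. *)
  have "x + norm x *\<^sub>R basis_sum A \<in> orthant A"
    unfolding orthant_def
  proof (intro CollectI conjI ballI)
    show "x + norm x *\<^sub>R basis_sum A \<in> coord_space A"
      using assms basis_sum_in_coord_space[of A] by (auto simp: coord_space_def)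
    show "0 \<le> (x + norm x *\<^sub>R basis_sum A) $ i" if "i \<in> A" for i
      using that component_le_norm_cart[of x i] by (simp add: basis_sum_nth)
  qed
  then show ?thesis by blast
qed

text \<open>
  A set that is invariant under \<open>u_tot\<close> is saturated for the quotient map, so membership can be
  tested on representatives.
\<close>

lemma quot_class_in_image_iff:
  assumes "\<And>x c. x \<in> \<sigma> \<Longrightarrow> x + c *\<^sub>R basis_sum N \<in> \<sigma>"
  shows "quot_class N y \<in> quot_class N ` \<sigma> \<longleftrightarrow> y \<in> \<sigma>"
proof
  assume "quot_class N y \<in> quot_class N ` \<sigma>"
  then obtain x where x: "x \<in> \<sigma>" "quot_class N y = quot_class N x" by blast
  have "y + 0 *\<^sub>R basis_sum N \<in> quot_class N y" unfolding quot_class_def by blast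
  then obtain c where "y = x + c *\<^sub>R basis_sum N" unfolding x(2) by (auto simp: quot_class_def)
  then show "y \<in> \<sigma>" using assms x(1) by simp
qed simp

lemma quot_class_translate: "quot_class N (x + c *\<^sub>R basis_sum N) = quot_class N x"
proof -
  have "\<exists>d. x + c *\<^sub>R basis_sum N + e *\<^sub>R basis_sum N = x + d *\<^sub>R basis_sum N"
    and "\<exists>d. x + e *\<^sub>R basis_sum N = x + c *\<^sub>R basis_sum N + d *\<^sub>R basis_sum N" for e
    by (rule exI[of _ "c + e"], simp add: scaleR_add_left)
      (rule exI[of _ "e - c"], simp add: scaleR_diff_left)
  then show ?thesis unfolding quot_class_def by blast
qed

section \<open>Nested sets and the map to the quotient fan\<close>

text \<open>
  Placing the common part \<open>inf g1 g2\<close> in the factor \<open>g1\<close> or in the factor \<open>g2\<close> gives two families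
  with comparable joins; the join map reflects the componentwise order, and in the component \<open>g1\<close> the
  second family is \<open>bot\<close>.
\<close>

lemma join_product_factors_disjoint:
  fixes f :: "'a::{finite, complete_lattice}"
  assumes jp: "join_product f F" and g: "g1 \<in> F" "g2 \<in> F" "g1 \<noteq> g2"
  shows "inf g1 g2 = bot"
proof -
  define a where "a = inf g1 g2"
  define x where "x = (\<lambda>i\<in>F. if i = g1 then a else bot)"
  define y where "y = (\<lambda>i\<in>F. if i = g2 then a else bot)"
  have xy: "x \<in> (\<Pi>\<^sub>E i\<in>F. {bot..i})" "y \<in> (\<Pi>\<^sub>E i\<in>F. {bot..i})"
    by (auto simp: x_def y_def a_def)
  have "(SUP i\<in>F. x i) \<le> a" by (intro SUP_least) (simp add: x_def)
  also have "a \<le> (SUP i\<in>F. y i)" using SUP_upper[OF g(2), of y] g by (simp add: y_def)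
  finally have "x g1 \<le> y g1" using jp xy g unfolding join_product_def by blast
  then show ?thesis using g by (simp add: x_def y_def a_def bot_unique)
qed

text \<open>
  For incomparable \<open>f\<close> and \<open>g\<close> the join is not in \<open>G\<close>, so \<open>[bot, sup f g]\<close> is a product over the
  maximal elements of \<open>G\<close> below it. These must separate \<open>f\<close> from \<open>g\<close>: one that is above both would
  be the join itself.
\<close>

lemma nested_comparable_or_disjoint:
  assumes G: "building_set G" and N: "nested G N" and f: "f \<in> N" and g: "g \<in> N"
  shows "f \<le> g \<or> g \<le> f \<or> inf f g = bot"
proof (rule ccontr)
  assume "\<not> ?thesis"
  then have inc: "\<not> f \<le> g" "\<not> g \<le> f" "inf f g \<noteq> bot" by auto
  have NG: "N \<subseteq> G" using N by (simp add: nested_def)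
  have "card {f, g} = 2" using inc by (auto simp: card_insert_if)
  then have "Sup {f, g} \<notin> G" using N f g inc unfolding nested_def
    by (metis empty_subsetI insertE insert_subset le_refl singletonD)
  then have notG: "sup f g \<notin> G" by simp
  have "bot < sup f g" using G f NG by (auto simp: building_set_def less_supI1)
  then have jp: "join_product (sup f g) (maximal_below G (sup f g))"
    using G notG by (simp add: building_set_def)
  have maximal: "\<exists>m \<in> maximal_below G (sup f g). h \<le> m" if h: "h \<in> G" "h \<le> sup f g" for h
  proof -
    obtain m where m: "h \<le> m" "m \<in> {k \<in> G. k \<le> sup f g}"
      "\<And>k. k \<in> {k \<in> G. k \<le> sup f g} \<Longrightarrow> m \<le> k \<Longrightarrow> k = m"
      using finite_has_maximal2[of "{k \<in> G. k \<le> sup f g}" h] h by auto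
    then show ?thesis by (auto simp: maximal_below_def)
  qed
  obtain m1 m2 where m: "m1 \<in> maximal_below G (sup f g)" "f \<le> m1"
    "m2 \<in> maximal_below G (sup f g)" "g \<le> m2"
    using maximal[of f] maximal[of g] f g NG by auto
  have "m1 \<noteq> m2"
  proof
    assume "m1 = m2"
    then have "sup f g \<le> m1" using m by simp
    then have "m1 = sup f g" using m(1) by (intro antisym) (auto simp: maximal_below_def)
    then show False using m(1) notG by (auto simp: maximal_below_def)
  qed
  then have "inf m1 m2 = bot" using join_product_factors_disjoint[OF jp] m by blast
  then have "inf f g = bot" using m by (metis bot_unique inf_mono)
  then show False using inc by simp
qed

lemma linear_Delta0: "linear (Delta0 N)"
  unfolding Delta0_def
  by (intro linear_compose_sum ballI linearI) (simp_all add: scaleR_add_left)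

lemma Delta0_Inl: "Delta0 N x $ Inl g = (if g \<in> N then x $ g else 0)"
proof -
  have "Delta0 N x $ Inl g = (\<Sum>h\<in>N. if h = g then x $ h else 0)"
    unfolding Delta0_def sum_component by (intro sum.cong) (auto simp: axis_def)
  then show ?thesis by simp
qed

lemma Delta0_Inr: "Delta0 N x $ Inr g = (if g \<in> N \<and> g \<noteq> top then x $ g else 0)"
proof -
  have "Delta0 N x $ Inr g = (\<Sum>h\<in>N. if h = g then (if g = top then 0 else x $ h) else 0)"
    unfolding Delta0_def sum_component by (intro sum.cong) (auto simp: axis_def)
  then show ?thesis by simp
qed

lemma linear_p_map: "linear (p_map N)"
  unfolding p_map_def
  by (intro linear_compose_sum ballI linearI) (simp_all add: scaleR_add_left)

text \<open>
  The vector inside \<open>phi\<close> has the coordinate \<open>\<Sum>f\<in>N - {i}. x $ f\<close> at each \<open>i \<in> N\<close>, because every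
  \<open>f \<noteq> i\<close> in \<open>N\<close> satisfies exactly one of \<open>i < f\<close>, \<open>f < i\<close> and \<open>inf i f = bot\<close>.
\<close>

lemma phi_Delta0:
  assumes G: "building_set G" and N: "nested G N" and x: "x \<in> coord_space N"
  shows "phi N (Delta0 N x) = quot_class N (- x)"
proof -
  let ?v = "\<Sum>f\<in>N. Delta0 N x $ Inl f *\<^sub>R basis_sum {g \<in> N. g < f} +
    Delta0 N x $ Inr f *\<^sub>R basis_sum {g \<in> N. f < g \<or> inf g f = bot}"
  have pos: "f \<noteq> bot" if "f \<in> N" for f
    using that G N by (auto simp: nested_def building_set_def)
  have "?v = - x + (\<Sum>f\<in>N. x $ f) *\<^sub>R basis_sum N"
  proof (rule vec_eq_iff[THEN iffD2, rule_format])
    fix i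
    show "?v $ i = (- x + (\<Sum>f\<in>N. x $ f) *\<^sub>R basis_sum N) $ i"
    proof (cases "i \<in> N")
      case True
      (* For f = top only the first summand is present, and i < top holds for all other i. *)
      have "(Delta0 N x $ Inl f *\<^sub>R basis_sum {g \<in> N. g < f} +
          Delta0 N x $ Inr f *\<^sub>R basis_sum {g \<in> N. f < g \<or> inf g f = bot}) $ i
          = x $ f - (if f = i then x $ f else 0)" if f: "f \<in> N" for f
      proof -
        have "f = i \<or> i < f \<or> f < i \<or> inf i f = bot"
          using nested_comparable_or_disjoint[OF G N True f] by auto
        moreover have "i < f \<Longrightarrow> inf i f \<noteq> bot" using pos[OF True] by (simp add: inf_absorb1)
        moreover have "\<not> top < i" by (simp add: not_less)
        moreover have "f \<noteq> i \<Longrightarrow> f = top \<Longrightarrow> i < f" using top.not_eq_extremum by metis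
        ultimately show ?thesis
          using f True pos[OF True] by (auto simp: Delta0_Inl Delta0_Inr basis_sum_nth)
      qed
      then have "?v $ i = (\<Sum>f\<in>N. x $ f - (if f = i then x $ f else 0))"
        unfolding sum_component by (intro sum.cong) auto
      also have "\<dots> = (\<Sum>f\<in>N. x $ f) - x $ i" using True by (simp add: sum_subtractf)
      finally show ?thesis using True by (simp add: basis_sum_nth)
    next
      case False
      then show ?thesis using x by (simp add: basis_sum_nth coord_space_def)
    qed
  qed
  then show ?thesis unfolding phi_def by (simp only: quot_class_translate)
qed

text \<open>
  Preimages of faces under a linear map are faces. All faces of the small orthant arise because
  \<open>Delta0\<close> has a linear left inverse \<open>r\<close>, reading off the coordinates \<open>g\<^sup>+\<close>, which maps the large
  orthant into the small one: a face \<open>F\<close> is the preimage under \<open>Delta0\<close> of its own preimage under \<open>r\<close>.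
\<close>

lemma Delta0_vimage_orthant_faces:
  "(\<lambda>\<tau>. {x \<in> coord_space N. Delta0 N x \<in> \<tau>}) ` cone_faces (orthant (N <+> N)) = cone_faces (orthant N)"
proof -
  define r :: "('a + 'a) rvec \<Rightarrow> 'a rvec" where "r z = (\<chi> i. z $ Inl i)" for z
  have lin_r: "linear r" by (intro linearI) (simp_all add: r_def vec_eq_iff)
  have r_Delta0: "r (Delta0 N x) = x" if "x \<in> coord_space N" for x
    using that by (auto simp: r_def vec_eq_iff Delta0_Inl coord_space_def)
  have r_orthant: "r ` orthant (N <+> N) \<subseteq> orthant N"
    by (force simp: orthant_iff coord_space_def r_def)
  have Delta0_orthant: "Delta0 N ` orthant N \<subseteq> orthant (N <+> N)"
  proof
    fix z assume "z \<in> Delta0 N ` orthant N"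
    then obtain x where x: "x \<in> orthant N" "z = Delta0 N x" by blast
    have "z $ i = 0" if "i \<notin> N <+> N" for i
      using that x by (cases i) (auto simp: Delta0_Inl Delta0_Inr)
    moreover have "0 \<le> z $ i" for i
      using x by (cases i) (auto simp: Delta0_Inl Delta0_Inr orthant_iff)
    ultimately show "z \<in> orthant (N <+> N)" by (simp add: orthant_iff coord_space_def)
  qed
  have zero: "0 \<in> F" if "F \<in> cone_faces (orthant A)" for F and A :: "'i::finite set"
    using that by (rule cone_faces_contain_0[OF conic_orthant])
  have Delta0_zero: "Delta0 N 0 = 0" and r_zero: "r 0 = 0"
    using linear_0 linear_Delta0 lin_r by blast+
  show ?thesis
  proof (intro subset_antisym subsetI)
    fix F assume "F \<in> (\<lambda>\<tau>. {x \<in> coord_space N. Delta0 N x \<in> \<tau>}) ` cone_faces (orthant (N <+> N))"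
    then obtain \<tau> where \<tau>: "\<tau> \<in> cone_faces (orthant (N <+> N))"
      "F = {x \<in> coord_space N. Delta0 N x \<in> \<tau>}" by blast
    have "F = {x \<in> orthant N. Delta0 N x \<in> \<tau>}"
      using \<tau> cone_faces_subset[OF \<tau>(1)] r_Delta0 r_orthant orthant_subset[of N]
      by (auto simp: image_subset_iff) (metis subsetD)
    also have "\<dots> \<in> cone_faces (orthant N)"
      using zero[OF \<tau>(1)] zero_in_orthant Delta0_zero
      by (intro cone_faces_linear_vimage[OF linear_Delta0 \<tau>(1) convex_orthant Delta0_orthant]) force
    finally show "F \<in> cone_faces (orthant N)" .
  next
    fix F assume F: "F \<in> cone_faces (orthant N)"
    let ?\<tau> = "{z \<in> orthant (N <+> N). r z \<in> F}"
    have "?\<tau> \<in> cone_faces (orthant (N <+> N))"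
      using zero[OF F] zero_in_orthant r_zero
      by (intro cone_faces_linear_vimage[OF lin_r F convex_orthant r_orthant]) force
    moreover have "F = {x \<in> coord_space N. Delta0 N x \<in> ?\<tau>}"
      using cone_faces_subset[OF F] orthant_subset[of N] Delta0_orthant r_Delta0 by force
    ultimately show "F \<in> (\<lambda>\<tau>. {x \<in> coord_space N. Delta0 N x \<in> \<tau>}) ` cone_faces (orthant (N <+> N))"
      by blast
  qed
qed

theorem proposition6p5:
  fixes G N :: "'a::{finite, complete_lattice} set" and B :: "'a set set"
  assumes "atomic_lattice TYPE('a)"
    and "building_set G"
    and "nested G N"
    and "boolean_building_set N B"
  shows "Delta0_pullback N (lightcone_subdivision N B) =
           linearity_subdivision (\<lambda>x. \<Sum>t\<in>B. MAX e\<in>t. x $ e) (orthant N) \<and>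
         (\<forall>s :: 'a rvec \<Rightarrow> 'a rvec.
            linear s \<longrightarrow> s ` coord_space atoms \<subseteq> coord_space N \<longrightarrow>
            (\<forall>x \<in> coord_space N. s (p_map N x) = x) \<longrightarrow>
            lightcone_subdivision_C N B =
              linearity_subdivision (\<lambda>y. \<Sum>t\<in>B. MAX e\<in>t. s y $ e) (cone_C N))"
proof -
  let ?V = "coord_space N"
  define h :: "'a rvec \<Rightarrow> real" where "h x = (\<Sum>t\<in>B. MAX e\<in>t. x $ e)" for x
  define L where "L = {\<lambda>x :: 'a rvec. \<Sum>t\<in>B. x $ c t | c. \<forall>t\<in>B. c t \<in> t}"
  have B: "\<forall>t\<in>B. t \<noteq> {}" "\<forall>t\<in>B. t \<subseteq> N"
    using assms(4) by (auto simp: boolean_building_set_def)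
  have h: "pointwise_max L h"
    unfolding L_def h_def using pointwise_max_sum_Max[OF B(1)] .
  have k: "\<forall>l\<in>L. l (basis_sum N) = of_nat (card B)"
  proof
    fix l assume "l \<in> L"
    then obtain c where c: "l = (\<lambda>x. \<Sum>t\<in>B. x $ c t)" "\<forall>t\<in>B. c t \<in> t" by (auto simp: L_def)
    then have "c t \<in> N" if "t \<in> B" for t using B(2) that by blast
    then show "l (basis_sum N) = of_nat (card B)" by (simp add: c(1) basis_sum_nth)
  qed
  note V = subspace_coord_space[of N] basis_sum_in_coord_space[of N]
  have h_orthant: "linearity_subdivision h (orthant N) =
      {H \<inter> F | H F. H \<in> linearity_subdivision h ?V \<and> F \<in> cone_faces (orthant N)}"
    using coord_space_translate_into_orthant zero_in_orthant
    by (intro linearity_subdivision_restrict[OF h k V convex_orthant conic_orthant _ orthant_subset]) auto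
  have uminus_V: "uminus ` ?V = ?V"
    using subspace_neg[OF V(1)] by (force simp: image_iff intro: bexI[of _ "- _"])
  have "linearity_subdivision (\<lambda>x. \<Sum>t\<in>B. MIN g\<in>t. x $ g) ?V = linearity_subdivision (\<lambda>x. h (- x)) ?V"
    unfolding sum_Min_eq_neg_sum_Max[OF B(1)] h_def by (rule linearity_subdivision_uminus)
  also have "\<dots> = linearity_subdivision (\<lambda>x. h (- x)) (uminus ` ?V)"
    using uminus_V by simp
  also have "\<dots> = (`) uminus ` linearity_subdivision h ?V"
    by (intro linearity_subdivision_linear_image linearI) auto
  finally have fan: "quotient_fan N B = (\<lambda>\<sigma>. quot_class N ` uminus ` \<sigma>) ` linearity_subdivision h ?V"
    unfolding quotient_fan_def by (simp add: image_image)
  (* A cone of the fan is the class of minus a cone sigma for h;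
     pulling back along minus the quotient map undoes the sign. *)
  have cell: "{x \<in> ?V. Delta0 N x \<in> {z \<in> \<tau>. phi N z \<in> quot_class N ` uminus ` \<sigma>}} =
      \<sigma> \<inter> {x \<in> ?V. Delta0 N x \<in> \<tau>}" if \<sigma>: "\<sigma> \<in> linearity_subdivision h ?V" for \<sigma> \<tau>
  proof -
    have "x + c *\<^sub>R basis_sum N \<in> uminus ` \<sigma>" if x: "x \<in> uminus ` \<sigma>" for x c
    proof -
      have "- x + (- c) *\<^sub>R basis_sum N \<in> \<sigma>"
        using x by (intro linearity_subdivision_translate[OF h k V \<sigma>]) auto
      then show ?thesis by (intro image_eqI[of _ _ "- x + (- c) *\<^sub>R basis_sum N"]) auto
    qed
    then have "phi N (Delta0 N x) \<in> quot_class N ` uminus ` \<sigma> \<longleftrightarrow> x \<in> \<sigma>" if "x \<in> ?V" for x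
      using quot_class_in_image_iff[of "uminus ` \<sigma>" N "- x"] phi_Delta0[OF assms(2,3) that] by auto
    then show ?thesis by blast
  qed
  have "Delta0_pullback N (lightcone_subdivision N B) =
      (\<Union>\<sigma>\<in>linearity_subdivision h ?V. (\<lambda>\<tau>. {x \<in> ?V. Delta0 N x \<in> {z \<in> \<tau>. phi N z \<in> quot_class N ` uminus ` \<sigma>}})
        ` cone_faces (orthant (N <+> N)))"
    unfolding Delta0_pullback_def lightcone_subdivision_def fan by blast
  also have "\<dots> = (\<Union>\<sigma>\<in>linearity_subdivision h ?V. (\<lambda>\<tau>. \<sigma> \<inter> {x \<in> ?V. Delta0 N x \<in> \<tau>})
        ` cone_faces (orthant (N <+> N)))"
    by (intro SUP_cong image_cong refl cell)
  also have "\<dots> = linearity_subdivision h (orthant N)"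
    unfolding h_orthant Delta0_vimage_orthant_faces[symmetric] by blast
  finally have pullback: "Delta0_pullback N (lightcone_subdivision N B) = linearity_subdivision h (orthant N)" .
  have "lightcone_subdivision_C N B = linearity_subdivision (\<lambda>y. h (s y)) (cone_C N)"
    if s: "linear s" "\<forall>x\<in>?V. s (p_map N x) = x" for s
    unfolding lightcone_subdivision_C_def pullback cone_C_def
    using s orthant_subset by (intro linearity_subdivision_linear_image[symmetric] linear_p_map) auto
  then show ?thesis using pullback unfolding h_def by blast
qed

end
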